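(* Let $G$ be a finite cubic graph. Then $\mathcal{F}(G,\mathbb{Z}_2\times\mathbb{Z}_2)$ is connected if and only if $\mathcal{K}(G,3)$ is connected.
   Context: Graphs may have multiple edges but no loops. For an abelian group $A$, an $A$-flow in $G$ (with respect to a fixed orientation) is a map $f:E(G)\to A$ such that at every vertex the sum of values on outgoing arcs equals the sum on incoming arcs; it is nowhere-zero if no edge receives $0_A$. (For $A=\mathbb{Z}_2\times\mathbb{Z}_2$ orientations are irrelevant since $a=-a$.) A cycle is a connected 2-regular subgraph. $\mathcal{F}(G,A)$ is the graph whose vertices are the nowhere-zero $A$-flows of $G$, two flows $f,g$ adjacent iff the support $\{e: (f-g)(e)\ne 0\}$ is the edge set of a cycle. The empty graph is considered connected. A proper 3-edge-coloring is considered unlabelled, i.e., as a partition of $E(G)$ into at most 3 classes (color classes), each a matching, colorings differing only by a permutation of colors being identified. Given such a coloring and two of its colors $i,j$, a Kempe chain is a connected component of the subgraph formed by the edges colored $i$ or $j$; a Kempe change exchanges colors $i$ and $j$ on one Kempe chain. $\mathcal{K}(G,3)$ is the graph whose vertices are the unlabelled proper 3-edge-colorings of $G$, two colorings adjacent iff they differ by one Kempe change. *)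

theory Defs
  imports
    "Graph_Theory.Digraph_Component"
    "HOL-Combinatorics.Transposition"
    "HOL-Library.Disjoint_Sets"
    "HOL-Library.FuncSet"
    "HOL-Library.Product_Plus"
    "HOL-Library.Z2"
begin

text \<open>
  An undirected loopless multigraph together with a fixed orientation of its edges is a
  loop-free digraph that may have parallel and antiparallel arcs: every arc is one edge.
  Apart from the conservation law of flows, all notions below ignore the direction of the arcs;
  in particular the library's \<^const>\<open>connected\<close> is connectedness of the underlying
  undirected graph, and it excludes the graph without vertices.
\<close>

definition regular_graph :: "nat \<Rightarrow> ('v, 'e) pre_digraph \<Rightarrow> bool" where
  "regular_graph d G \<longleftrightarrow> (\<forall>v \<in> verts G. in_degree G v + out_degree G v = d)"

definition cycle_subgraph :: "('v, 'e) pre_digraph \<Rightarrow> ('v, 'e) pre_digraph \<Rightarrow> bool" where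
  "cycle_subgraph C G \<longleftrightarrow> subgraph C G \<and> connected C \<and> regular_graph 2 C"

definition connected_or_empty :: "('v, 'e) pre_digraph \<Rightarrow> bool" where
  "connected_or_empty G \<longleftrightarrow> verts G = {} \<or> connected G"


subsection \<open>Nowhere-zero flows\<close>

text \<open>Flows are extensional, so that they correspond exactly to maps defined on the edge set.\<close>

definition is_flow :: "('v, 'e) pre_digraph \<Rightarrow> ('e \<Rightarrow> 'a::ab_group_add) \<Rightarrow> bool" where
  "is_flow G f \<longleftrightarrow> f \<in> extensional (arcs G) \<and>
     (\<forall>v \<in> verts G. (\<Sum>e \<in> out_arcs G v. f e) = (\<Sum>e \<in> in_arcs G v. f e))"

definition nowhere_zero_flow :: "('v, 'e) pre_digraph \<Rightarrow> ('e \<Rightarrow> 'a::ab_group_add) \<Rightarrow> bool" where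
  "nowhere_zero_flow G f \<longleftrightarrow> is_flow G f \<and> (\<forall>e \<in> arcs G. f e \<noteq> 0)"

definition flow_graph :: "('v, 'e) pre_digraph \<Rightarrow> ('e \<Rightarrow> 'a::ab_group_add) pair_pre_digraph" where
  "flow_graph G = \<lparr>
     pverts = {f. nowhere_zero_flow G f},
     parcs = {(f, g). nowhere_zero_flow G f \<and> nowhere_zero_flow G g \<and>
       (\<exists>C. cycle_subgraph C G \<and> arcs C = {e \<in> arcs G. f e - g e \<noteq> 0})}\<rparr>"


subsection \<open>Unlabelled edge colorings and Kempe changes\<close>

definition is_matching :: "('v, 'e) pre_digraph \<Rightarrow> 'e set \<Rightarrow> bool" where
  "is_matching G M \<longleftrightarrow> M \<subseteq> arcs G \<and>
     (\<forall>e \<in> M. \<forall>e' \<in> M. e \<noteq> e' \<longrightarrow> {tail G e, head G e} \<inter> {tail G e', head G e'} = {})"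

definition unlabelled_coloring :: "('v, 'e) pre_digraph \<Rightarrow> nat \<Rightarrow> 'e set set \<Rightarrow> bool" where
  "unlabelled_coloring G k P \<longleftrightarrow>
     partition_on (arcs G) P \<and> finite P \<and> card P \<le> k \<and> (\<forall>M \<in> P. is_matching G M)"

text \<open>
  Kempe changes are performed on a labelled representative with colors \<open>{..<k}\<close>, so that a
  color that is not used (an empty class) may also take part in a change.
\<close>

definition color_classes :: "('v, 'e) pre_digraph \<Rightarrow> nat \<Rightarrow> ('e \<Rightarrow> nat) \<Rightarrow> 'e set set" where
  "color_classes G k c = {{e \<in> arcs G. c e = i} | i. i < k} - {{}}"

definition labels :: "('v, 'e) pre_digraph \<Rightarrow> nat \<Rightarrow> ('e \<Rightarrow> nat) \<Rightarrow> 'e set set \<Rightarrow> bool" where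
  "labels G k c P \<longleftrightarrow> (\<forall>e \<in> arcs G. c e < k) \<and> color_classes G k c = P"

definition edge_subgraph :: "('v, 'e) pre_digraph \<Rightarrow> 'e set \<Rightarrow> ('v, 'e) pre_digraph" where
  "edge_subgraph G F =
     \<lparr>verts = tail G ` F \<union> head G ` F, arcs = F, tail = tail G, head = head G\<rparr>"

definition kempe_chain ::
  "('v, 'e) pre_digraph \<Rightarrow> ('e \<Rightarrow> nat) \<Rightarrow> nat \<Rightarrow> nat \<Rightarrow> ('v, 'e) pre_digraph \<Rightarrow> bool" where
  "kempe_chain G c i j C \<longleftrightarrow>
     pre_digraph.max_subgraph (edge_subgraph G {e \<in> arcs G. c e = i \<or> c e = j}) connected C"

definition kempe_swap ::
  "('e \<Rightarrow> nat) \<Rightarrow> nat \<Rightarrow> nat \<Rightarrow> ('v, 'e) pre_digraph \<Rightarrow> 'e \<Rightarrow> nat" where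
  "kempe_swap c i j C = (\<lambda>e. if e \<in> arcs C then transpose i j (c e) else c e)"

definition kempe_change :: "('v, 'e) pre_digraph \<Rightarrow> nat \<Rightarrow> 'e set set \<Rightarrow> 'e set set \<Rightarrow> bool" where
  "kempe_change G k P Q \<longleftrightarrow> (\<exists>c i j C. labels G k c P \<and> i < k \<and> j < k \<and> i \<noteq> j \<and>
     kempe_chain G c i j C \<and> labels G k (kempe_swap c i j C) Q)"

text \<open>
  Exchanging two colors on their only Kempe chain yields the same unlabelled coloring; such
  trivial changes are not edges of the Kempe graph.
\<close>

definition kempe_graph :: "('v, 'e) pre_digraph \<Rightarrow> nat \<Rightarrow> 'e set set pair_pre_digraph" where
  "kempe_graph G k = \<lparr>
     pverts = {P. unlabelled_coloring G k P},
     parcs = {(P, Q). unlabelled_coloring G k P \<and> unlabelled_coloring G k Q \<and>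
       P \<noteq> Q \<and> kempe_change G k P Q}\<rparr>"

end

theory Submission
  imports Defs
begin

text \<open>
  At a vertex of a cubic graph three nonzero elements of the Klein four-group sum to zero iff they
  are distinct, so nowhere-zero flows are labelled proper 3-edge-colorings. The difference of two
  adjacent flows is a constant \<open>a\<close> on a cycle on which neither flow takes the value \<open>a\<close>; such a
  cycle is a Kempe chain in the two other colors and the step is a Kempe change. Conversely every
  Kempe change lifts to a step between flows, so walks of colorings lift to walks of flows whose
  end is correct up to a permutation of the colors. Permutations are realised by walks too:
  a transposition of two colors is performed by switching all their Kempe chains one after another.
\<close>

section \<open>Connectedness and degrees\<close>

text \<open>
  The cut criterion spares all explicit walks: components appear as minimal closed vertex sets.
\<close>

lemma connected_iff_no_cut:
  assumes "wf_digraph H"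
  shows "connected H \<longleftrightarrow> verts H \<noteq> {} \<and>
    (\<forall>S. S \<inter> verts H \<noteq> {} \<longrightarrow> (\<forall>e \<in> arcs H. tail H e \<in> S \<longleftrightarrow> head H e \<in> S) \<longrightarrow> verts H \<subseteq> S)"
    (is "_ \<longleftrightarrow> _ \<and> ?cut")
proof -
  interpret wf_digraph H by fact
  let ?R = "rtrancl_on (verts H) ((arcs_ends H)\<^sup>s)"
  have "?cut" if conn: "\<forall>u \<in> verts H. \<forall>v \<in> verts H. (u, v) \<in> ?R"
  proof (intro allI impI subsetI)
    fix S v
    assume "S \<inter> verts H \<noteq> {}" and closed: "\<forall>e \<in> arcs H. tail H e \<in> S \<longleftrightarrow> head H e \<in> S"
      and "v \<in> verts H"
    then obtain u where u: "u \<in> S" "u \<in> verts H" by blast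
    with conn \<open>v \<in> verts H\<close> have "(u, v) \<in> ?R" by blast
    then show "v \<in> S"
      by (induct rule: rtrancl_on_induct) (use u closed in \<open>auto simp: symcl_def arcs_ends_conv\<close>)
  qed
  moreover have "(u, v) \<in> ?R" if cut: ?cut and uv: "u \<in> verts H" "v \<in> verts H" for u v
  proof -
    let ?S = "{w. (u, w) \<in> ?R}"
    have step: "(u, y) \<in> ?R" if "(u, x) \<in> ?R" "(x, y) \<in> (arcs_ends H)\<^sup>s" for x y
    proof (rule rtrancl_on_into_rtrancl_on[OF that])
      show "y \<in> verts H" using that(2) by (auto simp: symcl_def arcs_ends_conv)
    qed
    have "(tail H e, head H e) \<in> (arcs_ends H)\<^sup>s" "(head H e, tail H e) \<in> (arcs_ends H)\<^sup>s"
      if "e \<in> arcs H" for e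
      using that by (auto simp: symcl_def arcs_ends_conv)
    then have "\<forall>e \<in> arcs H. tail H e \<in> ?S \<longleftrightarrow> head H e \<in> ?S"
      using step by blast
    moreover have "?S \<inter> verts H \<noteq> {}" using uv by auto
    ultimately show ?thesis using cut uv(2) by blast
  qed
  ultimately show ?thesis unfolding connected_conv by blast
qed

text \<open>Symmetry absorbs the symmetric closure in \<open>connected\<close>, and a walk from a
  vertex stays inside \<open>pverts D\<close>, so the restricted closure is the plain one. Without
  vertices the right side is vacuous.\<close>

lemma connected_or_empty_with_proj_iff:
  assumes "parcs D \<subseteq> pverts D \<times> pverts D" and "sym (parcs D)"
  shows "connected_or_empty (with_proj D) \<longleftrightarrow>
    (\<forall>x \<in> pverts D. \<forall>y \<in> pverts D. (x, y) \<in> (parcs D)\<^sup>*)"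
proof -
  have sym: "(parcs D)\<^sup>s = parcs D"
    using assms(2) by (auto simp: symcl_def sym_def)
  have "(x, y) \<in> rtrancl_on (pverts D) (parcs D) \<longleftrightarrow> (x, y) \<in> (parcs D)\<^sup>*"
    if "x \<in> pverts D" for x y
  proof
    assume "(x, y) \<in> (parcs D)\<^sup>*"
    then show "(x, y) \<in> rtrancl_on (pverts D) (parcs D)"
      by induct (use that assms(1) in \<open>auto intro: rtrancl_on_into_rtrancl_on\<close>)
  qed (rule rtrancl_on_rtranclI)
  then show ?thesis
    by (auto simp: connected_or_empty_def connected_conv sym)
qed

text \<open>Orientation is forgotten: over the Klein group, conservation at a vertex only says that
  the values on these edges sum to zero.\<close>

definition incident :: "('v, 'e) pre_digraph \<Rightarrow> 'v \<Rightarrow> 'e set" where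
  "incident G v = {e \<in> arcs G. tail G e = v \<or> head G e = v}"

lemma incident_eq: "incident G v = in_arcs G v \<union> out_arcs G v"
  by (auto simp: incident_def in_arcs_def out_arcs_def)

lemma (in loopfree_digraph) in_arcs_out_arcs_disjoint: "in_arcs G v \<inter> out_arcs G v = {}"
  using no_loops by (auto simp: in_arcs_def out_arcs_def)

lemma card_incident:
  assumes "finite (arcs G)" and "\<And>e. e \<in> arcs G \<Longrightarrow> tail G e \<noteq> head G e"
  shows "card (incident G v) = in_degree G v + out_degree G v"
  unfolding incident_eq in_degree_def out_degree_def
  by (rule card_Un_disjoint) (use assms in \<open>auto simp: in_arcs_def out_arcs_def\<close>)

lemma incident_subgraph:
  assumes "subgraph C G"
  shows "incident C v = incident G v \<inter> arcs C"
  using assms by (auto simp: incident_def subgraph_def compatible_def)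

lemma subgraph_edge_subgraph:
  assumes "wf_digraph G" and "F \<subseteq> arcs G"
  shows "subgraph (edge_subgraph G F) G"
proof -
  interpret wf_digraph G by fact
  show ?thesis
    using assms by (auto simp: subgraph_def edge_subgraph_def compatible_def subset_iff
      intro!: wf_digraph.intro)
qed

section \<open>The Klein four-group\<close>

lemma bit_pair_add_self [simp]: "x + x = (0 :: bit \<times> bit)"
  by (cases x) (auto simp: zero_prod_def)

lemma bit_pair_add_eq_0_iff: "x + y = 0 \<longleftrightarrow> x = (y :: bit \<times> bit)"
  by (metis add_right_cancel bit_pair_add_self)

lemma bit_pair_add_left_self [simp]: "x + (x + y) = (y :: bit \<times> bit)"
  by (simp flip: add.assoc)

text \<open>Two equal values cancel and leave the nonzero third one; distinct values exhaust the
  nonzero elements, whose sum is zero.\<close>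

lemma sum3_bit_pair_eq_0_iff:
  fixes x y z :: "bit \<times> bit"
  assumes "x \<noteq> 0" "y \<noteq> 0" "z \<noteq> 0"
  shows "x + y + z = 0 \<longleftrightarrow> x \<noteq> y \<and> x \<noteq> z \<and> y \<noteq> z"
proof -
  obtain a b c d e f where "x = (a, b)" "y = (c, d)" "z = (e, f)" by (metis surj_pair)
  then show ?thesis using assms
    by (cases a; cases b; cases c; cases d; cases e; cases f) (auto simp: zero_prod_def)
qed

text \<open>\<open>x + y\<close> is the third nonzero element. Avoiding one value thus means
  carrying one of two colors, which is how Kempe chains enter.\<close>

lemma bit_pair_ne_add_iff:
  fixes x y z :: "bit \<times> bit"
  assumes "x \<noteq> 0" "y \<noteq> 0" "z \<noteq> 0" "x \<noteq> y"
  shows "z \<noteq> x + y \<longleftrightarrow> z = x \<or> z = y"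
  using sum3_bit_pair_eq_0_iff[OF assms(1-3)] assms(4)
  by (metis bit_pair_add_eq_0_iff)

definition color_value :: "nat \<Rightarrow> bit \<times> bit" where
  "color_value i = (if i = 0 then (1, 0) else if i = 1 then (0, 1) else (1, 1))"

text \<open>Zero also gets the color 2: every argument yields a legal color, but the map is
  injective only on nonzero values.\<close>

definition value_color :: "bit \<times> bit \<Rightarrow> nat" where
  "value_color x = (if x = (1, 0) then 0 else if x = (0, 1) then 1 else 2)"

lemma value_color_less [simp]: "value_color x < 3"
  by (simp add: value_color_def)

lemma color_value_nonzero [simp]: "color_value i \<noteq> 0"
  by (simp add: color_value_def zero_prod_def)

lemma value_color_color_value [simp]: "i < 3 \<Longrightarrow> value_color (color_value i) = i"
  by (auto simp: color_value_def value_color_def)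

lemma color_value_value_color [simp]: "x \<noteq> 0 \<Longrightarrow> color_value (value_color x) = x"
proof -
  obtain a b where "x = (a, b)" by (metis surj_pair)
  then show "x \<noteq> 0 \<Longrightarrow> color_value (value_color x) = x"
    by (cases a; cases b) (auto simp: color_value_def value_color_def zero_prod_def)
qed

lemma value_color_eq_iff: "x \<noteq> 0 \<Longrightarrow> y \<noteq> 0 \<Longrightarrow> value_color x = value_color y \<longleftrightarrow> x = y"
  by (metis color_value_value_color)

lemma color_value_eq_iff: "i < 3 \<Longrightarrow> j < 3 \<Longrightarrow> color_value i = color_value j \<longleftrightarrow> i = j"
  by (metis value_color_color_value)

section \<open>Flows and colorings of cubic graphs\<close>

locale cubic_graph = fin_digraph G + loopfree_digraph G for G :: "('v, 'e) pre_digraph" (structure) +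
  assumes cubic: "regular_graph 3 G"
begin

lemma finite_incident [simp]: "finite (incident G v)"
  by (simp add: incident_def)

lemma incident_obtain:
  assumes "v \<in> verts G"
  obtains e1 e2 e3 where "incident G v = {e1, e2, e3}" "e1 \<noteq> e2" "e1 \<noteq> e3" "e2 \<noteq> e3"
proof -
  have "card (incident G v) = 3"
    using cubic assms card_incident[of G v] no_loops by (simp add: regular_graph_def)
  then show ?thesis by (auto simp: card_3_iff intro: that)
qed

lemma flow_iff:
  fixes f :: "'e \<Rightarrow> bit \<times> bit"
  shows "is_flow G f \<longleftrightarrow> f \<in> extensional (arcs G) \<and> (\<forall>v \<in> verts G. sum f (incident G v) = 0)"
proof -
  have "sum f (incident G v) = sum f (in_arcs G v) + sum f (out_arcs G v)" for v
    unfolding incident_eq by (rule sum.union_disjoint) (auto simp: in_arcs_out_arcs_disjoint)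
  then show ?thesis
    unfolding is_flow_def by (auto simp: bit_pair_add_eq_0_iff)
qed

text \<open>At each vertex, \<open>sum3_bit_pair_eq_0_iff\<close> turns conservation into
  injectivity, that is, into properness of a coloring.\<close>

lemma nowhere_zero_flow_iff:
  fixes f :: "'e \<Rightarrow> bit \<times> bit"
  shows "nowhere_zero_flow G f \<longleftrightarrow>
    f \<in> extensional (arcs G) \<and> (\<forall>e \<in> arcs G. f e \<noteq> 0) \<and> (\<forall>v \<in> verts G. inj_on f (incident G v))"
proof -
  have "sum f (incident G v) = 0 \<longleftrightarrow> inj_on f (incident G v)"
    if "v \<in> verts G" and nz: "\<forall>e \<in> arcs G. f e \<noteq> 0" for v
  proof -
    obtain e1 e2 e3 where e: "incident G v = {e1, e2, e3}" "e1 \<noteq> e2" "e1 \<noteq> e3" "e2 \<noteq> e3"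
      using incident_obtain \<open>v \<in> verts G\<close> by metis
    then have "{e1, e2, e3} \<subseteq> arcs G" by (auto simp: incident_def)
    with nz have "f e1 \<noteq> 0" "f e2 \<noteq> 0" "f e3 \<noteq> 0" by auto
    note sum3_bit_pair_eq_0_iff[OF this]
    with e show ?thesis by (auto simp: inj_on_def add.assoc)
  qed
  then show ?thesis unfolding nowhere_zero_flow_def flow_iff by blast
qed

text \<open>The three distinct values at \<open>v\<close> exhaust the nonzero elements, so exactly
  one edge carries \<open>a\<close>. The edges of the two other colors thus form a spanning
  2-regular subgraph.\<close>

lemma card_incident_other_colors:
  assumes "nowhere_zero_flow G f" and "v \<in> verts G" and "(a :: bit \<times> bit) \<noteq> 0"
  shows "card {e \<in> incident G v. f e \<noteq> a} = 2"
proof -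
  obtain e1 e2 e3 where e: "incident G v = {e1, e2, e3}" "e1 \<noteq> e2" "e1 \<noteq> e3" "e2 \<noteq> e3"
    using incident_obtain assms(2) by metis
  then have "{e1, e2, e3} \<subseteq> arcs G" by (auto simp: incident_def)
  with assms(1) have nz: "f e1 \<noteq> 0" "f e2 \<noteq> 0" "f e3 \<noteq> 0"
    by (auto simp: nowhere_zero_flow_def)
  have inj: "f e1 \<noteq> f e2" "f e1 \<noteq> f e3" "f e2 \<noteq> f e3"
    using assms(1,2) e unfolding nowhere_zero_flow_iff inj_on_def by blast+
  have sum0: "f e1 + f e2 + f e3 = 0"
    using sum3_bit_pair_eq_0_iff[OF nz] inj by simp
  have "f e1 = a \<or> f e2 = a \<or> f e3 = a"
  proof (rule ccontr)
    assume "\<not> ?thesis"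
    then have "f e1 + f e2 + a = 0"
      using sum3_bit_pair_eq_0_iff[OF nz(1,2) assms(3)] inj by simp
    with sum0 have "f e3 = a" by (metis add_left_cancel)
    with \<open>\<not> ?thesis\<close> show False by simp
  qed
  then obtain d where d: "d \<in> incident G v" "f d = a" using e(1) by blast
  moreover have "inj_on f (incident G v)" using assms(1,2) by (simp add: nowhere_zero_flow_iff)
  ultimately have "{e \<in> incident G v. f e \<noteq> a} = incident G v - {d}"
    by (auto simp: inj_on_def)
  then show ?thesis using d(1) e by (simp add: card_Diff_singleton)
qed

lemma cycle_subgraph_iff:
  "cycle_subgraph C G \<longleftrightarrow> subgraph C G \<and> connected C \<and>
    (\<forall>v \<in> verts C. card (incident G v \<inter> arcs C) = 2)"
proof -
  have "in_degree C v + out_degree C v = card (incident G v \<inter> arcs C)" if sub: "subgraph C G" for v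
  proof -
    have C: "arcs C \<subseteq> arcs G" "tail C = tail G" "head C = head G"
      using sub by (auto simp: subgraph_def compatible_def)
    then have "finite (arcs C)" "\<And>e. e \<in> arcs C \<Longrightarrow> tail C e \<noteq> head C e"
      using no_loops finite_subset[OF C(1)] by auto
    from card_incident[OF this] show ?thesis
      by (simp add: incident_subgraph[OF sub])
  qed
  then show ?thesis
    by (auto simp: cycle_subgraph_def regular_graph_def)
qed

section \<open>Moves in the flow graph\<close>

text \<open>On an edge whose value is neither 0 nor \<open>a\<close>, adding a nonzero
  \<open>a\<close> exchanges the two remaining nonzero values: a Kempe swap in additive
  form.\<close>

definition shift_on :: "'e set \<Rightarrow> bit \<times> bit \<Rightarrow> ('e \<Rightarrow> bit \<times> bit) \<Rightarrow> 'e \<Rightarrow> bit \<times> bit" where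
  "shift_on A a f = (\<lambda>e. if e \<in> A then f e + a else f e)"

text \<open>These are the edge sets of vertex-disjoint unions of cycles. Degree 0 is allowed so that
  the property survives the removal of a whole cycle.\<close>

definition degrees_0_2 :: "'e set \<Rightarrow> bool" where
  "degrees_0_2 F \<longleftrightarrow> F \<subseteq> arcs G \<and> (\<forall>v \<in> verts G. card (incident G v \<inter> F) \<in> {0, 2})"

text \<open>At each vertex \<open>a\<close> is added not at all or twice, and
  \<open>a + a = 0\<close>; a value can only become zero where it was \<open>a\<close>.\<close>

lemma nowhere_zero_flow_shift_on:
  assumes f: "nowhere_zero_flow G f" and F: "degrees_0_2 F" and a: "\<forall>e \<in> F. f e \<noteq> a"
  shows "nowhere_zero_flow G (shift_on F a f)"
proof -
  have "sum (shift_on F a f) (incident G v) = 0" if "v \<in> verts G" for v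
  proof -
    have "sum (shift_on F a f) (incident G v) =
        sum f (incident G v) + (\<Sum>e \<in> incident G v. if e \<in> F then a else 0)"
      unfolding sum.distrib[symmetric] by (rule sum.cong) (auto simp: shift_on_def)
    also have "\<dots> = (\<Sum>e \<in> incident G v. if e \<in> F then a else 0)"
      using f that by (simp add: nowhere_zero_flow_def flow_iff)
    also have "\<dots> = (\<Sum>e \<in> incident G v \<inter> F. a)"
      by (simp add: sum.inter_restrict)
    also have "\<dots> = 0"
    proof -
      have "card (incident G v \<inter> F) = 0 \<or> card (incident G v \<inter> F) = 2"
        using F that by (auto simp: degrees_0_2_def)
      then show ?thesis
      proof
        assume "card (incident G v \<inter> F) = 2"
        then obtain x y where "incident G v \<inter> F = {x, y}" "x \<noteq> y" by (meson card_2_iff)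
        then show ?thesis by simp
      qed simp
    qed
    finally show ?thesis .
  qed
  moreover have "shift_on F a f \<in> extensional (arcs G)"
    using f F by (auto simp: nowhere_zero_flow_def is_flow_def shift_on_def extensional_def degrees_0_2_def)
  moreover have "\<forall>e \<in> arcs G. shift_on F a f e \<noteq> 0"
    using f a by (auto simp: nowhere_zero_flow_def shift_on_def bit_pair_add_eq_0_iff)
  ultimately show ?thesis by (simp add: nowhere_zero_flow_def flow_iff)
qed

abbreviation flow_adj :: "('e \<Rightarrow> bit \<times> bit) rel" where
  "flow_adj \<equiv> parcs (flow_graph G)"

lemma flow_adj_iff:
  "(f, g) \<in> flow_adj \<longleftrightarrow> nowhere_zero_flow G f \<and> nowhere_zero_flow G g \<and>
    (\<exists>C. cycle_subgraph C G \<and> arcs C = {e \<in> arcs G. f e \<noteq> g e})"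
  by (simp add: flow_graph_def)

lemma sym_flow_adj: "sym flow_adj"
proof (rule symI)
  fix f g assume "(f, g) \<in> flow_adj"
  then show "(g, f) \<in> flow_adj" unfolding flow_adj_iff by (simp add: eq_commute conj_commute)
qed

lemma degrees_0_2_cycle:
  assumes "cycle_subgraph C G"
  shows "degrees_0_2 (arcs C)"
proof -
  have C: "subgraph C G" "\<forall>v \<in> verts C. card (incident G v \<inter> arcs C) = 2"
    using assms by (auto simp: cycle_subgraph_iff)
  have "incident G v \<inter> arcs C = {}" if "v \<notin> verts C" for v
    using C(1) that by (auto simp: incident_def subgraph_def compatible_def wf_digraph_def)
  then have "card (incident G v \<inter> arcs C) \<in> {0, 2}" for v
    using C(2) by (cases "v \<in> verts C") auto
  then show ?thesis using C(1) by (auto simp: degrees_0_2_def subgraph_def)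
qed

lemma flow_adj_shift_on_cycle:
  assumes f: "nowhere_zero_flow G f" and C: "cycle_subgraph C G"
    and a: "\<forall>e \<in> arcs C. f e \<noteq> a" "a \<noteq> 0"
  shows "(f, shift_on (arcs C) a f) \<in> flow_adj"
proof -
  have "arcs C = {e \<in> arcs G. f e \<noteq> shift_on (arcs C) a f e}"
    using a(2) C by (auto simp: shift_on_def cycle_subgraph_def subgraph_def)
  then show ?thesis
    using f C nowhere_zero_flow_shift_on[OF f degrees_0_2_cycle[OF C] a(1)] flow_adj_iff by blast
qed

text \<open>A nonempty vertex set of least size among those closed under the edges of
  \<open>F\<close> spans a component. It keeps all edges of \<open>F\<close> at its vertices, so it
  is 2-regular, and its removal leaves the degrees elsewhere untouched.\<close>

lemma obtain_cycle:
  assumes F: "degrees_0_2 F" and "F \<noteq> {}"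
  obtains C where "cycle_subgraph C G" "arcs C \<subseteq> F" "arcs C \<noteq> {}" "degrees_0_2 (F - arcs C)"
proof -
  let ?W = "tail G ` F \<union> head G ` F"
  let ?closed = "\<lambda>S. S \<subseteq> ?W \<and> S \<noteq> {} \<and> (\<forall>e \<in> F. tail G e \<in> S \<longleftrightarrow> head G e \<in> S)"
  have FG: "F \<subseteq> arcs G" using F by (simp add: degrees_0_2_def)
  then have finF: "finite F" by (rule finite_subset) simp
  have "?closed ?W" using \<open>F \<noteq> {}\<close> by auto
  from ex_has_least_nat[of ?closed, OF this, of card]
  obtain S where S: "?closed S" and min: "\<And>T. ?closed T \<Longrightarrow> card S \<le> card T" by blast
  have finS: "finite S" using S finF finite_subset[of S ?W] by auto
  define C where "C = \<lparr>verts = S, arcs = {e \<in> F. tail G e \<in> S}, tail = tail G, head = head G\<rparr>"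
  have C [simp]: "verts C = S" "arcs C = {e \<in> F. tail G e \<in> S}" "tail C = tail G" "head C = head G"
    by (auto simp: C_def)
  have SG: "S \<subseteq> verts G" using S FG by (auto simp: subset_iff)
  have wfC: "wf_digraph C" using S by unfold_locales auto
  have sub: "subgraph C G"
    using SG FG wfC wf_digraph by (auto simp: subgraph_def compatible_def)
  have "connected C"
    unfolding connected_iff_no_cut[OF wfC]
  proof (intro conjI allI impI)
    show "verts C \<noteq> {}" using S by simp
    fix T assume T: "T \<inter> verts C \<noteq> {}" "\<forall>e \<in> arcs C. tail C e \<in> T \<longleftrightarrow> head C e \<in> T"
    \<comment> \<open>A cut of \<open>C\<close> would give a smaller closed set, against
      minimality.\<close>
    have "?closed (T \<inter> S)" using S T by auto
    then have "card S \<le> card (T \<inter> S)" by (rule min)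
    then have "T \<inter> S = S" using finS by (intro card_seteq) auto
    then show "verts C \<subseteq> T" by auto
  qed
  moreover have in_S: "incident G v \<inter> arcs C = incident G v \<inter> F" if "v \<in> S" for v
    using S that by (auto simp: incident_def)
  moreover have out_S: "incident G v \<inter> arcs C = {}" if "v \<notin> S" for v
    using S that by (auto simp: incident_def)
  moreover have "card (incident G v \<inter> F) = 2" if "v \<in> S" for v
  proof -
    have "v \<in> ?W" using S that by blast
    then obtain e where "e \<in> F" "tail G e = v \<or> head G e = v" by auto
    then have "incident G v \<inter> F \<noteq> {}" using FG by (auto simp: incident_def)
    then have "card (incident G v \<inter> F) \<noteq> 0" by simp
    moreover have "card (incident G v \<inter> F) \<in> {0, 2}" using F SG that by (auto simp: degrees_0_2_def)
    ultimately show ?thesis by simp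
  qed
  ultimately have "cycle_subgraph C G"
    using sub by (simp add: cycle_subgraph_iff)
  moreover have "arcs C \<noteq> {}"
  proof -
    obtain v where "v \<in> S" using S by blast
    moreover from this have "v \<in> ?W" using S by blast
    ultimately obtain e where "e \<in> F" "tail G e \<in> S" using S by auto
    then show ?thesis by auto
  qed
  moreover have "card (incident G v \<inter> (F - arcs C)) \<in> {0, 2}" if "v \<in> verts G" for v
  proof (cases "v \<in> S")
    case True
    then have "incident G v \<inter> (F - arcs C) = {}" using in_S by blast
    then show ?thesis by simp
  next
    case False
    then have "incident G v \<inter> (F - arcs C) = incident G v \<inter> F" using out_S by blast
    then show ?thesis using F that by (simp add: degrees_0_2_def)
  qed
  then have "degrees_0_2 (F - arcs C)" using FG by (auto simp: degrees_0_2_def)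
  moreover have "arcs C \<subseteq> F" by auto
  ultimately show ?thesis using that by blast
qed

text \<open>The cycles of \<open>F\<close> are shifted one at a time. They share no edges, so on the
  remaining ones \<open>f\<close> is unchanged and still avoids \<open>a\<close>, and the shifts
  compose to the shift on \<open>F\<close>.\<close>

lemma flow_adj_rtrancl_shift_on:
  assumes "nowhere_zero_flow G f" and "degrees_0_2 F" and "\<forall>e \<in> F. f e \<noteq> a" and "a \<noteq> 0"
  shows "(f, shift_on F a f) \<in> flow_adj\<^sup>*"
proof -
  have "finite F" using assms(2) finite_subset[of F "arcs G"] by (simp add: degrees_0_2_def)
  then show ?thesis using assms
  proof (induction F arbitrary: f rule: finite_psubset_induct)
    case (psubset F)
    show ?case
    proof (cases "F = {}")
      case True
      then show ?thesis by (simp add: shift_on_def)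
    next
      case False
      with psubset.prems(2) obtain C
        where C: "cycle_subgraph C G" "arcs C \<subseteq> F" "arcs C \<noteq> {}" "degrees_0_2 (F - arcs C)"
        using obtain_cycle by blast
      let ?g = "shift_on (arcs C) a f"
      have adj: "(f, ?g) \<in> flow_adj"
        using psubset.prems C(1,2) by (intro flow_adj_shift_on_cycle) auto
      then have "nowhere_zero_flow G ?g" by (simp add: flow_adj_iff)
      moreover have "\<forall>e \<in> F - arcs C. ?g e \<noteq> a"
        using psubset.prems(3) by (auto simp: shift_on_def)
      moreover have "F - arcs C \<subset> F" using C(2,3) by auto
      ultimately have "(?g, shift_on (F - arcs C) a ?g) \<in> flow_adj\<^sup>*"
        using psubset.IH C(4) psubset.prems(4) by blast
      moreover have "shift_on (F - arcs C) a ?g = shift_on F a f"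
        using C(2) by (auto simp: shift_on_def fun_eq_iff)
      ultimately show ?thesis using adj by (simp add: converse_rtrancl_into_rtrancl)
    qed
  qed
qed

section \<open>Permutations of the three values\<close>

definition swap_others :: "bit \<times> bit \<Rightarrow> ('e \<Rightarrow> bit \<times> bit) \<Rightarrow> 'e \<Rightarrow> bit \<times> bit" where
  "swap_others a f = shift_on {e \<in> arcs G. f e \<noteq> a} a f"

lemma degrees_0_2_other_colors:
  assumes "nowhere_zero_flow G f" and "(a :: bit \<times> bit) \<noteq> 0"
  shows "degrees_0_2 {e \<in> arcs G. f e \<noteq> a}"
proof -
  have "incident G v \<inter> {e \<in> arcs G. f e \<noteq> a} = {e \<in> incident G v. f e \<noteq> a}" for v
    by (auto simp: incident_def)
  then show ?thesis
    using card_incident_other_colors[OF assms(1) _ assms(2)] by (auto simp: degrees_0_2_def)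
qed

text \<open>The edges avoiding \<open>a\<close> form a union of cycles; adding \<open>a\<close>
  there exchanges the two other values, which differ by \<open>a\<close>.\<close>

lemma swap_others:
  assumes "nowhere_zero_flow G f" and "a \<noteq> 0"
  shows "nowhere_zero_flow G (swap_others a f)" and "(f, swap_others a f) \<in> flow_adj\<^sup>*"
  unfolding swap_others_def using assms degrees_0_2_other_colors[OF assms]
  by (auto intro: nowhere_zero_flow_shift_on flow_adj_rtrancl_shift_on)

text \<open>A nonzero value other than \<open>a\<close> stays other than \<open>a\<close>. The
  classes are thus preserved for a second transposition.\<close>

lemma swap_others_eq_iff:
  assumes "nowhere_zero_flow G f" and "a \<noteq> 0" and "e \<in> arcs G" "e' \<in> arcs G"
  shows "swap_others a f e = swap_others a f e' \<longleftrightarrow> f e = f e'"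
  using assms by (auto simp: swap_others_def shift_on_def nowhere_zero_flow_def)

text \<open>
  Two transpositions suffice: the first makes the flows agree on the class of one edge \<open>e1\<close>,
  the second fixes that class and makes them agree on the class of some edge \<open>e2\<close> that still
  disagrees. The third class is then determined.
\<close>

lemma flow_adj_rtrancl_if_same_classes:
  assumes f: "nowhere_zero_flow G f" and g: "nowhere_zero_flow G g"
    and same: "\<And>e e'. e \<in> arcs G \<Longrightarrow> e' \<in> arcs G \<Longrightarrow> f e = f e' \<longleftrightarrow> g e = g e'"
  shows "(f, g) \<in> flow_adj\<^sup>*"
proof -
  have ext: "h = g" if "nowhere_zero_flow G h" "\<forall>e \<in> arcs G. h e = g e" for h
    using that g by (auto simp: nowhere_zero_flow_iff intro: extensionalityI)
  have nz: "h e \<noteq> 0" if "nowhere_zero_flow G h" "e \<in> arcs G" for h :: "'e \<Rightarrow> bit \<times> bit" and e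
    using that by (simp add: nowhere_zero_flow_def)
  \<comment> \<open>To be applied after the first transposition. Agreement at \<open>e1\<close>
    spreads to its class by \<open>same\<close>, and \<open>?k\<close> below keeps that
    class.\<close>
  have agree2: "(h, g) \<in> flow_adj\<^sup>*"
    if h: "nowhere_zero_flow G h" and e1: "e1 \<in> arcs G" "h e1 = g e1"
      and same: "\<And>e e'. e \<in> arcs G \<Longrightarrow> e' \<in> arcs G \<Longrightarrow> h e = h e' \<longleftrightarrow> g e = g e'" for h e1
  proof (cases "\<exists>e2 \<in> arcs G. h e2 \<noteq> g e2")
    case True
    then obtain e2 where e2: "e2 \<in> arcs G" "h e2 \<noteq> g e2" by blast
    let ?k = "swap_others (h e1) h"
    have "?k e = g e" if e: "e \<in> arcs G" for e
    proof (cases "h e = h e1")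
      case True
      then show ?thesis using e e1 same[OF e e1(1)] by (simp add: swap_others_def shift_on_def)
    next
      case False
      have ne: "h e2 \<noteq> h e1" "g e2 \<noteq> g e1" "g e \<noteq> g e1"
        using same[OF e2(1) e1(1)] same[OF e e1(1)] e1(2) e2(2) False by metis+
      \<comment> \<open>\<open>g e2\<close> avoids both \<open>h e1\<close>, which is the value
        \<open>g e1\<close>, and \<open>h e2\<close>, so it is the third element.\<close>
      have "g e2 = h e1 + h e2"
        using bit_pair_ne_add_iff[of "h e1" "h e2" "g e2"] nz h g e1 e2 ne by metis
      moreover have "h e = h e2 \<or> h e = h e1 + h e2" "g e = g e2 \<or> g e = g e1 + g e2"
        using bit_pair_ne_add_iff[of "h e1" "h e2" "h e"] bit_pair_ne_add_iff[of "g e1" "g e2" "g e"]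
          nz h g e e1 e2 ne False by metis+
      moreover have "h e = h e2 \<longleftrightarrow> g e = g e2" by (rule same[OF e e2(1)])
      ultimately have "g e = h e + h e1"
        using e1(2) by (metis add.commute bit_pair_add_left_self)
      then show ?thesis using e False by (simp add: swap_others_def shift_on_def)
    qed
    then have "?k = g" using ext swap_others(1)[OF h nz[OF h e1(1)]] by blast
    then show ?thesis using swap_others(2)[OF h nz[OF h e1(1)]] by simp
  next
    case False
    then have "h = g" using ext h by blast
    then show ?thesis by simp
  qed
  show ?thesis
  proof (cases "\<exists>e1 \<in> arcs G. f e1 \<noteq> g e1")
    case True
    then obtain e1 where e1: "e1 \<in> arcs G" "f e1 \<noteq> g e1" by blast
    \<comment> \<open>The exchange of \<open>f e1\<close> and \<open>g e1\<close> fixes the third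
      nonzero value, which is their sum.\<close>
    define a where "a = f e1 + g e1"
    have a: "a \<noteq> 0" using e1(2) by (simp add: a_def bit_pair_add_eq_0_iff)
    have "f e1 \<noteq> a" using nz[OF g e1(1)] by (simp add: a_def)
    then have "swap_others a f e1 = g e1"
      using e1(1) by (simp add: swap_others_def shift_on_def a_def)
    then have "(swap_others a f, g) \<in> flow_adj\<^sup>*"
      using agree2[OF swap_others(1)[OF f a] e1(1)] same swap_others_eq_iff[OF f a] by simp
    with swap_others(2)[OF f a] show ?thesis by (rule rtrancl_trans)
  next
    case False
    then have "f = g" using ext f by blast
    then show ?thesis by simp
  qed
qed

end

section \<open>Kempe changes\<close>

lemma color_classes_cong:
  assumes "\<And>e. e \<in> arcs G \<Longrightarrow> c e = c' e"
  shows "color_classes G k c = color_classes G k c'"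
proof -
  have "{e \<in> arcs G. c e = i} = {e \<in> arcs G. c' e = i}" for i
    using assms by auto
  then show ?thesis by (simp add: color_classes_def)
qed

text \<open>Sharing a class is a statement about \<open>P\<close> alone, so labellings of the same
  unlabelled coloring can be compared through it.\<close>

lemma labels_same_class_iff:
  assumes "labels G k c P" and "e \<in> arcs G" "e' \<in> arcs G"
  shows "(\<exists>M \<in> P. e \<in> M \<and> e' \<in> M) \<longleftrightarrow> c e = c e'"
proof
  assume "\<exists>M \<in> P. e \<in> M \<and> e' \<in> M"
  then show "c e = c e'" using assms(1) by (auto simp: labels_def color_classes_def)
next
  let ?M = "{d \<in> arcs G. c d = c e}"
  assume "c e = c e'"
  then have "e \<in> ?M" "e' \<in> ?M" using assms(2,3) by simp_all
  moreover have "?M \<in> P"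
    using assms(1,2) by (auto simp: labels_def color_classes_def)
  ultimately show "\<exists>M \<in> P. e \<in> M \<and> e' \<in> M" by (intro bexI[of _ ?M] conjI)
qed

text \<open>The swap keeps the set of edges colored \<open>i\<close> or \<open>j\<close>, so
  \<open>C\<close> is still a chain, and swapping twice restores the labelling.\<close>

lemma kempe_change_sym:
  assumes "kempe_change G k P Q"
  shows "kempe_change G k Q P"
proof -
  obtain c i j C where c: "labels G k c P" "i < k" "j < k" "i \<noteq> j" "kempe_chain G c i j C"
    "labels G k (kempe_swap c i j C) Q"
    using assms unfolding kempe_change_def by blast
  let ?c = "kempe_swap c i j C"
  have "?c e = i \<or> ?c e = j \<longleftrightarrow> c e = i \<or> c e = j" for e
    by (auto simp: kempe_swap_def transpose_def)
  then have "kempe_chain G ?c i j C" using c(5) by (simp add: kempe_chain_def)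
  moreover have "kempe_swap ?c i j C = c" by (auto simp: kempe_swap_def fun_eq_iff)
  ultimately show ?thesis using c unfolding kempe_change_def by metis
qed

text \<open>The classes are numbered by a bijection with \<open>{..<card P}\<close>. As
  \<open>card P \<le> k\<close>, all numbers are colors, and the colors left over have empty
  classes, which \<open>color_classes\<close> discards.\<close>

lemma unlabelled_coloring_obtain_labels:
  assumes "unlabelled_coloring G k P"
  obtains c where "labels G k c P"
proof -
  have P: "partition_on (arcs G) P" "finite P" "card P \<le> k"
    using assms by (auto simp: unlabelled_coloring_def)
  obtain h where h: "bij_betw h P {..<card P}"
    using ex_bij_betw_finite_nat[OF P(2)] by (auto simp: atLeast0LessThan)
  define c where "c e = h (THE M. M \<in> P \<and> e \<in> M)" for e
  have c: "c e = h M" if "M \<in> P" "e \<in> M" for e M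
  proof -
    have "(THE M. M \<in> P \<and> e \<in> M) = M"
    proof (rule the_equality)
      show "N = M" if "N \<in> P \<and> e \<in> N" for N
        using that \<open>M \<in> P\<close> \<open>e \<in> M\<close> P(1) by (auto simp: partition_on_def dest: disjointD)
    qed (use that in simp)
    then show ?thesis by (simp add: c_def)
  qed
  have cover: "\<exists>M \<in> P. e \<in> M" if "e \<in> arcs G" for e
    using that P(1) by (auto simp: partition_on_def)
  have sub: "M \<subseteq> arcs G" "M \<noteq> {}" if "M \<in> P" for M
    using that P(1) by (auto simp: partition_on_def)
  have class_eq: "{e \<in> arcs G. c e = h M} = M" if M: "M \<in> P" for M
  proof -
    have "e \<in> M" if "e \<in> arcs G" "c e = h M" for e
    proof -
      obtain N where N: "N \<in> P" "e \<in> N" using cover \<open>e \<in> arcs G\<close> by blast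
      then have "h N = h M" using c that(2) by simp
      then have "N = M" using h N M by (auto simp: bij_betw_def inj_on_def)
      then show ?thesis using N by simp
    qed
    then show ?thesis using sub[OF M] c[OF M] by auto
  qed
  have h_less: "h M < k" if "M \<in> P" for M
    using bij_betwE[OF h] that P(3) by (meson lessThan_iff order_less_le_trans)
  have "color_classes G k c = P"
  proof (intro equalityI subsetI)
    fix M assume "M \<in> color_classes G k c"
    then obtain i e where i: "M = {e \<in> arcs G. c e = i}" "e \<in> arcs G" "c e = i"
      unfolding color_classes_def by blast
    obtain N where N: "N \<in> P" "e \<in> N" using cover i(2) by blast
    then have "M = N" using class_eq[OF N(1)] c[OF N] i by simp
    then show "M \<in> P" using N by simp
  next
    fix M assume M: "M \<in> P"
    have "\<exists>i. M = {e \<in> arcs G. c e = i} \<and> i < k"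
      using class_eq[OF M] h_less[OF M] by (intro exI[of _ "h M"]) simp
    then show "M \<in> color_classes G k c"
      using sub(2)[OF M] by (simp add: color_classes_def)
  qed
  moreover have "\<forall>e \<in> arcs G. c e < k" using cover c h_less by fastforce
  ultimately show ?thesis using that by (simp add: labels_def)
qed

section \<open>Colorings as flows and back\<close>

context cubic_graph
begin

text \<open>Edges with a common end meet at a vertex, so the classes are matchings iff no vertex
  sees a color twice. The partition and the bound on its size come from the labelling.\<close>

lemma unlabelled_coloring_iff_proper:
  assumes "labels G k c P"
  shows "unlabelled_coloring G k P \<longleftrightarrow> (\<forall>v \<in> verts G. inj_on c (incident G v))"
proof -
  have less: "\<forall>e \<in> arcs G. c e < k" and P: "P = color_classes G k c"
    using assms by (auto simp: labels_def)
  have "P \<subseteq> (\<lambda>i. {e \<in> arcs G. c e = i}) ` {..<k}"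
    unfolding P color_classes_def by auto
  then have "finite P" "card P \<le> k"
    using surj_card_le[of "{..<k}" P] by (auto dest: finite_subset)
  moreover have "\<Union> P = arcs G" using less unfolding P color_classes_def by blast
  then have "partition_on (arcs G) P"
    unfolding partition_on_def disjoint_def P color_classes_def by auto
  moreover have "(\<forall>M \<in> P. is_matching G M) \<longleftrightarrow> (\<forall>v \<in> verts G. inj_on c (incident G v))"
  proof
    assume *: "\<forall>M \<in> P. is_matching G M"
    show "\<forall>v \<in> verts G. inj_on c (incident G v)"
    proof (intro ballI inj_onI)
      fix v e e' assume e: "e \<in> incident G v" "e' \<in> incident G v" "c e = c e'"
      then have "e \<in> arcs G" "e' \<in> arcs G" by (auto simp: incident_def)
      with labels_same_class_iff[OF assms this] e(3)
      obtain M where "M \<in> P" "e \<in> M" "e' \<in> M" by blast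
      moreover have "v \<in> {tail G e, head G e} \<inter> {tail G e', head G e'}"
        using e by (auto simp: incident_def)
      ultimately show "e = e'" using * unfolding is_matching_def by blast
    qed
  next
    assume inj: "\<forall>v \<in> verts G. inj_on c (incident G v)"
    show "\<forall>M \<in> P. is_matching G M"
    proof
      fix M assume "M \<in> P"
      then obtain i where M: "M = {e \<in> arcs G. c e = i}"
        unfolding P color_classes_def by blast
      have "e = e'" if "e \<in> M" "e' \<in> M" "v \<in> {tail G e, head G e} \<inter> {tail G e', head G e'}" for e e' v
      proof -
        have "v \<in> verts G" "e \<in> incident G v" "e' \<in> incident G v" "c e = c e'"
          using that by (auto simp: M incident_def)
        then show ?thesis using inj by (auto dest: inj_onD)
      qed
      then show "is_matching G M" unfolding is_matching_def by (auto simp: M)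
    qed
  qed
  ultimately show ?thesis by (simp add: unlabelled_coloring_def)
qed

definition flow_of :: "('e \<Rightarrow> nat) \<Rightarrow> 'e \<Rightarrow> bit \<times> bit" where
  "flow_of c = restrict (\<lambda>e. color_value (c e)) (arcs G)"

definition coloring_of :: "('e \<Rightarrow> bit \<times> bit) \<Rightarrow> 'e set set" where
  "coloring_of f = color_classes G 3 (\<lambda>e. value_color (f e))"

lemma labels_coloring_of: "labels G 3 (\<lambda>e. value_color (f e)) (coloring_of f)"
  by (simp add: labels_def coloring_of_def)

lemma unlabelled_coloring_coloring_of:
  assumes "nowhere_zero_flow G f"
  shows "unlabelled_coloring G 3 (coloring_of f)"
  unfolding unlabelled_coloring_iff_proper[OF labels_coloring_of]
proof (intro ballI inj_onI)
  fix v e e' assume v: "v \<in> verts G" and e: "e \<in> incident G v" "e' \<in> incident G v"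
    and eq: "value_color (f e) = value_color (f e')"
  have "f e \<noteq> 0" "f e' \<noteq> 0"
    using e assms by (auto simp: nowhere_zero_flow_def incident_def)
  with eq have "f e = f e'" by (simp add: value_color_eq_iff)
  moreover have "inj_on f (incident G v)" using assms v by (simp add: nowhere_zero_flow_iff)
  ultimately show "e = e'" using e by (simp add: inj_on_eq_iff)
qed

text \<open>Colors below 3 correspond bijectively to nonzero values, so \<open>coloring_of\<close>
  undoes \<open>flow_of\<close>; as labellings exist, every unlabelled coloring comes from a
  flow.\<close>

lemma flow_of_coloring:
  assumes "labels G 3 c P" and "unlabelled_coloring G 3 P"
  shows "nowhere_zero_flow G (flow_of c)" and "coloring_of (flow_of c) = P"
proof -
  have less: "\<forall>e \<in> arcs G. c e < 3" using assms(1) by (simp add: labels_def)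
  have "\<forall>v \<in> verts G. inj_on c (incident G v)"
    using assms unlabelled_coloring_iff_proper by blast
  then show "nowhere_zero_flow G (flow_of c)"
    unfolding nowhere_zero_flow_iff
    using less by (simp add: flow_of_def inj_on_def incident_def color_value_eq_iff)
  have "coloring_of (flow_of c) = color_classes G 3 c"
    unfolding coloring_of_def by (rule color_classes_cong) (use less in \<open>simp add: flow_of_def\<close>)
  then show "coloring_of (flow_of c) = P" using assms(1) by (simp add: labels_def)
qed

text \<open>Such flows differ only in the naming of the classes, so a fibre of
  \<open>coloring_of\<close> lies within one component of the flow graph.\<close>

lemma flow_adj_rtrancl_if_same_coloring:
  assumes f: "nowhere_zero_flow G f" and g: "nowhere_zero_flow G g"
    and "coloring_of f = coloring_of g"
  shows "(f, g) \<in> flow_adj\<^sup>*"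
proof (rule flow_adj_rtrancl_if_same_classes[OF f g])
  fix e e' assume e: "e \<in> arcs G" "e' \<in> arcs G"
  then have "value_color (f e) = value_color (f e') \<longleftrightarrow> value_color (g e) = value_color (g e')"
    using labels_same_class_iff[OF labels_coloring_of[of f] e]
      labels_same_class_iff[OF labels_coloring_of[of g] e] assms(3) by simp
  then show "f e = f e' \<longleftrightarrow> g e = g e'"
    using f g e by (simp add: nowhere_zero_flow_def value_color_eq_iff)
qed

text \<open>
  A cycle avoiding the value \<open>a\<close> uses both edges of other values at each of its vertices,
  so it cannot be enlarged.
\<close>

lemma max_connected_subgraph_iff_cycle:
  fixes f :: "'e \<Rightarrow> bit \<times> bit"
  assumes f: "nowhere_zero_flow G f" and a: "a \<noteq> 0"
  defines "F \<equiv> {e \<in> arcs G. f e \<noteq> a}"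
  shows "pre_digraph.max_subgraph (edge_subgraph G F) connected C \<longleftrightarrow>
    cycle_subgraph C G \<and> arcs C \<subseteq> F"
proof -
  let ?H = "edge_subgraph G F"
  have H [simp]: "verts ?H = tail G ` F \<union> head G ` F" "arcs ?H = F" "tail ?H = tail G" "head ?H = head G"
    by (auto simp: edge_subgraph_def)
  have HG: "subgraph ?H G" by (rule subgraph_edge_subgraph) (auto simp: F_def wf_digraph)
  then have wfH: "wf_digraph ?H" by (simp add: subgraph_def)
  have deg: "card (incident G v \<inter> F) = 2" if "v \<in> verts G" for v
  proof -
    have "incident G v \<inter> F = {e \<in> incident G v. f e \<noteq> a}" by (auto simp: F_def incident_def)
    then show ?thesis using card_incident_other_colors[OF f that a] by simp
  qed
  show ?thesis
  proof
    assume "pre_digraph.max_subgraph ?H connected C"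
    then have CH: "subgraph C ?H" and conn: "connected C"
      and max: "\<And>C'. subgraph C C' \<Longrightarrow> subgraph C' ?H \<Longrightarrow> connected C' \<Longrightarrow> C' = C"
      unfolding pre_digraph.max_subgraph_def by blast+
    have CG: "subgraph C G" using CH HG by (rule subgraph_trans)
    have C: "verts C \<subseteq> verts ?H" "arcs C \<subseteq> F" "tail C = tail G" "head C = head G" "wf_digraph C"
      using CH by (auto simp: subgraph_def compatible_def)
    \<comment> \<open>Adding an edge of \<open>F\<close> at a vertex of \<open>C\<close> keeps the
      subgraph connected, so by maximality the edge is already there.\<close>
    have absorb: "e \<in> arcs C" if e: "e \<in> F" "tail G e \<in> verts C \<or> head G e \<in> verts C" for e
    proof -
      let ?C = "\<lparr>verts = verts C \<union> {tail G e, head G e}, arcs = insert e (arcs C),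
        tail = tail G, head = head G\<rparr>"
      have wf: "wf_digraph ?C"
        using C(3-5) by unfold_locales (auto simp: wf_digraph_def)
      have "connected ?C"
        unfolding connected_iff_no_cut[OF wf]
      proof (intro conjI allI impI)
        fix T assume T: "T \<inter> verts ?C \<noteq> {}" "\<forall>e \<in> arcs ?C. tail ?C e \<in> T \<longleftrightarrow> head ?C e \<in> T"
        then have "T \<inter> verts C \<noteq> {}" using e(2) by auto
        then have "verts C \<subseteq> T"
          using conn T(2) C(3,4) unfolding connected_iff_no_cut[OF C(5)] by simp
        then show "verts ?C \<subseteq> T" using e(2) T(2) by auto
      qed simp
      moreover have "subgraph C ?C" using C wf by (auto simp: subgraph_def compatible_def)
      moreover have "subgraph ?C ?H" using C e(1) wf wfH by (auto simp: subgraph_def compatible_def)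
      ultimately have "?C = C" using max by blast
      then have "arcs ?C = arcs C" by (rule arg_cong)
      then show ?thesis by auto
    qed
    have "card (incident G v \<inter> arcs C) = 2" if "v \<in> verts C" for v
    proof -
      have "incident G v \<inter> arcs C = incident G v \<inter> F"
        using C(2) absorb that by (auto simp: incident_def)
      moreover have "v \<in> verts G" using CG that by (auto simp: subgraph_def)
      ultimately show ?thesis using deg by simp
    qed
    then show "cycle_subgraph C G \<and> arcs C \<subseteq> F"
      using CG conn C(2) by (simp add: cycle_subgraph_iff)
  next
    assume "cycle_subgraph C G \<and> arcs C \<subseteq> F"
    then have CG: "subgraph C G" and conn: "connected C" and "arcs C \<subseteq> F"
      and deg2: "\<forall>v \<in> verts C. card (incident G v \<inter> arcs C) = 2"
      by (auto simp: cycle_subgraph_iff)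
    have C: "verts C \<subseteq> verts G" "tail C = tail G" "head C = head G" "wf_digraph C"
      using CG by (auto simp: subgraph_def compatible_def)
    \<comment> \<open>Both sides have two elements and one contains the other, so \<open>C\<close>
      has all edges of \<open>F\<close> at its vertices.\<close>
    have all: "incident G v \<inter> arcs C = incident G v \<inter> F" if "v \<in> verts C" for v
    proof (rule card_subset_eq)
      show "card (incident G v \<inter> arcs C) = card (incident G v \<inter> F)"
        using deg deg2 that C(1) by auto
    qed (use \<open>arcs C \<subseteq> F\<close> in auto)
    have "v \<in> verts ?H" if "v \<in> verts C" for v
    proof -
      have "card (incident G v \<inter> F) \<noteq> 0" using deg[of v] C(1) that by auto
      then have "incident G v \<inter> F \<noteq> {}" by (metis card.empty)
      then obtain e where "e \<in> F" "tail G e = v \<or> head G e = v" by (auto simp: incident_def)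
      then show ?thesis by auto
    qed
    then have CH: "subgraph C ?H"
      using \<open>arcs C \<subseteq> F\<close> C wfH by (auto simp: subgraph_def compatible_def)
    have "C' = C" if C': "subgraph C C'" "subgraph C' ?H" "connected C'" for C'
    proof -
      have C'_simps: "arcs C' \<subseteq> F" "tail C' = tail G" "head C' = head G" "wf_digraph C'"
        "verts C \<subseteq> verts C'" "arcs C \<subseteq> arcs C'"
        using C'(1,2) by (auto simp: subgraph_def compatible_def)
      have arc_in_C: "e \<in> arcs C" if e: "e \<in> arcs C'" "tail G e \<in> verts C \<or> head G e \<in> verts C" for e
      proof -
        obtain v where v: "v \<in> verts C" "tail G e = v \<or> head G e = v" using e(2) by blast
        then have "e \<in> incident G v \<inter> F" using e(1) C'_simps(1) by (auto simp: incident_def F_def)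
        then show ?thesis using all[OF v(1)] by blast
      qed
      have ends_in_C: "tail G e \<in> verts C" "head G e \<in> verts C" if "e \<in> arcs C" for e
        using C that by (auto simp: wf_digraph_def)
      \<comment> \<open>\<open>verts C\<close> is closed under the edges of \<open>C'\<close>; the
        cut criterion for \<open>C'\<close> then leaves no further vertices.\<close>
      have "verts C \<inter> verts C' \<noteq> {}"
        using C'_simps(5) conn unfolding connected_iff_no_cut[OF C(4)] by blast
      moreover have "\<forall>e \<in> arcs C'. tail C' e \<in> verts C \<longleftrightarrow> head C' e \<in> verts C"
        using arc_in_C ends_in_C C'_simps(2,3) by metis
      ultimately have "verts C' \<subseteq> verts C"
        using C'(3) unfolding connected_iff_no_cut[OF C'_simps(4)] by blast
      then have "verts C' = verts C" using C'_simps(5) by blast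
      moreover have "arcs C' = arcs C"
        using C'_simps(4,6) \<open>verts C' \<subseteq> verts C\<close> arc_in_C C'_simps(2) by (auto simp: wf_digraph_def)
      ultimately show ?thesis using C C'_simps by simp
    qed
    then show "pre_digraph.max_subgraph ?H connected C"
      using CH conn unfolding pre_digraph.max_subgraph_def by blast
  qed
qed

text \<open>\<open>f + g\<close> satisfies conservation and vanishes on the edges off the cycle. At
  a vertex of the cycle its two remaining values sum to zero, so they are equal, and connectedness
  spreads this value over the cycle.\<close>

lemma flow_adj_obtain:
  assumes "(f, g) \<in> flow_adj"
  obtains C a where "cycle_subgraph C G" "arcs C = {e \<in> arcs G. f e \<noteq> g e}" "arcs C \<noteq> {}"
    "\<And>e. e \<in> arcs C \<Longrightarrow> f e + g e = a"
proof -
  obtain C where cyc: "cycle_subgraph C G" and A: "arcs C = {e \<in> arcs G. f e \<noteq> g e}"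
    and f: "nowhere_zero_flow G f" and g: "nowhere_zero_flow G g"
    using assms flow_adj_iff by blast
  have CG: "subgraph C G" and conn: "connected C"
    and deg: "\<forall>v \<in> verts C. card (incident G v \<inter> arcs C) = 2"
    using cyc by (auto simp: cycle_subgraph_iff)
  have C: "verts C \<subseteq> verts G" "tail C = tail G" "head C = head G" "wf_digraph C"
    using CG by (auto simp: subgraph_def compatible_def)
  have eq: "f x + g x = f y + g y"
    if v: "v \<in> verts C" and xy: "x \<in> incident G v \<inter> arcs C" "y \<in> incident G v \<inter> arcs C" for v x y
  proof (cases "x = y")
    case False
    have I: "incident G v \<inter> arcs C = {x, y}"
      using deg v xy False by (intro card_subset_eq[symmetric]) auto
    have "(\<Sum>e \<in> incident G v. f e + g e) = 0"
      using f g v C(1) by (auto simp: nowhere_zero_flow_def flow_iff sum.distrib)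
    moreover have "(\<Sum>e \<in> incident G v. f e + g e) = (\<Sum>e \<in> incident G v \<inter> arcs C. f e + g e)"
      by (rule sum.mono_neutral_right) (auto simp: A incident_def)
    ultimately have "(f x + g x) + (f y + g y) = 0" using False by (simp add: I)
    then show ?thesis by (simp only: bit_pair_add_eq_0_iff)
  qed simp
  have ne: "incident G v \<inter> arcs C \<noteq> {}" if "v \<in> verts C" for v
    using deg that by (metis card.empty zero_neq_numeral)
  obtain v0 where v0: "v0 \<in> verts C"
    using conn unfolding connected_iff_no_cut[OF C(4)] by blast
  then obtain e0 where e0: "e0 \<in> incident G v0 \<inter> arcs C" using ne by blast
  define a where "a = f e0 + g e0"
  \<comment> \<open>\<open>S\<close> collects the vertices at which all cycle edges carry
    \<open>a\<close>; it is closed under the arcs of \<open>C\<close>, so the cut criterion yields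
    all of \<open>verts C\<close>.\<close>
  define S where "S = {v. \<forall>e \<in> incident G v \<inter> arcs C. f e + g e = a}"
  have "v0 \<in> S" unfolding S_def a_def using eq[OF v0] e0 by blast
  then have "S \<inter> verts C \<noteq> {}" using v0 by blast
  moreover have "\<forall>e \<in> arcs C. tail C e \<in> S \<longleftrightarrow> head C e \<in> S"
  proof
    fix e assume e: "e \<in> arcs C"
    have iff: "v \<in> S \<longleftrightarrow> f e + g e = a" if "v \<in> verts C" "e \<in> incident G v" for v
      unfolding S_def using eq[OF that(1)] that e by blast
    have "tail C e \<in> verts C" "head C e \<in> verts C" using C(4) e by (auto simp: wf_digraph_def)
    moreover have "e \<in> incident G (tail C e)" "e \<in> incident G (head C e)"
      using e A C by (auto simp: incident_def)
    ultimately show "tail C e \<in> S \<longleftrightarrow> head C e \<in> S" using iff by simp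
  qed
  ultimately have S: "verts C \<subseteq> S"
    using conn unfolding connected_iff_no_cut[OF C(4)] by blast
  have "f e + g e = a" if "e \<in> arcs C" for e
  proof -
    have "tail G e \<in> S" using S C that by (auto simp: wf_digraph_def)
    then show ?thesis using that A by (auto simp: S_def incident_def)
  qed
  with cyc A e0 that show ?thesis by blast
qed

section \<open>Projecting steps between flows and lifting Kempe changes\<close>

lemma kempe_graph_arcs_iff:
  "(P, Q) \<in> parcs (kempe_graph G 3) \<longleftrightarrow> unlabelled_coloring G 3 P \<and> unlabelled_coloring G 3 Q \<and>
    P \<noteq> Q \<and> kempe_change G 3 P Q"
  by (simp add: kempe_graph_def)

text \<open>On the cycle the flows differ by \<open>a\<close>, so neither takes the value
  \<open>a\<close> there, as the other would vanish. Both use only \<open>f e0\<close> and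
  \<open>g e0\<close> there, and adding \<open>a\<close> exchanges these. The two colorings may
  coincide.\<close>

lemma kempe_change_if_flow_adj:
  assumes "(f, g) \<in> flow_adj"
  shows "kempe_change G 3 (coloring_of f) (coloring_of g)"
proof -
  obtain C a where C: "cycle_subgraph C G" "arcs C = {e \<in> arcs G. f e \<noteq> g e}" "arcs C \<noteq> {}"
    and a: "\<And>e. e \<in> arcs C \<Longrightarrow> f e + g e = a"
    using flow_adj_obtain[OF assms] by metis
  have f: "nowhere_zero_flow G f" and g: "nowhere_zero_flow G g"
    using assms by (auto simp: flow_adj_iff)
  have nz: "f e \<noteq> 0" "g e \<noteq> 0" if "e \<in> arcs G" for e
    using f g that by (auto simp: nowhere_zero_flow_def)
  obtain e0 where e0: "e0 \<in> arcs C" using C(3) by blast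
  then have e0G: "e0 \<in> arcs G" "f e0 \<noteq> g e0" using C(2) by auto
  have a_eq: "a = f e0 + g e0" using a[OF e0] by simp
  have a0: "a \<noteq> 0" using e0G by (simp add: a_eq bit_pair_add_eq_0_iff)
  define c where "c = (\<lambda>e. value_color (f e))"
  define i j where "i = value_color (f e0)" and "j = value_color (g e0)"
  have third: "z \<noteq> a \<longleftrightarrow> z = f e0 \<or> z = g e0" if "z \<noteq> 0" for z
    unfolding a_eq using bit_pair_ne_add_iff nz e0G that by blast
  have "(c e = i \<or> c e = j) \<longleftrightarrow> f e \<noteq> a" if "e \<in> arcs G" for e
    using third[OF nz(1)[OF that]] nz that e0G by (simp add: c_def i_def j_def value_color_eq_iff)
  then have F: "{e \<in> arcs G. c e = i \<or> c e = j} = {e \<in> arcs G. f e \<noteq> a}" by blast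
  have "f e \<noteq> a" if "e \<in> arcs C" for e
  proof -
    have "g e \<noteq> 0" using nz C(2) that by auto
    then show ?thesis using a[OF that] by auto
  qed
  then have "kempe_chain G c i j C"
    unfolding kempe_chain_def F max_connected_subgraph_iff_cycle[OF f a0] using C by auto
  moreover have swap: "kempe_swap c i j C e = value_color (g e)" if e: "e \<in> arcs G" for e
  proof (cases "e \<in> arcs C")
    case True
    have "f e = f e0 \<or> f e = g e0"
      using third[OF nz(1)[OF e]] \<open>\<And>e. e \<in> arcs C \<Longrightarrow> f e \<noteq> a\<close>[OF True] by simp
    moreover have "g e = f e + (f e0 + g e0)" using a[OF True] a_eq by (metis bit_pair_add_left_self)
    ultimately have "f e = f e0 \<and> g e = g e0 \<or> f e = g e0 \<and> g e = f e0"
      by (metis add.commute bit_pair_add_left_self)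
    then show ?thesis using True by (auto simp: kempe_swap_def c_def i_def j_def)
  next
    case False
    then show ?thesis using e C(2) by (simp add: kempe_swap_def c_def)
  qed
  have "color_classes G 3 (kempe_swap c i j C) = coloring_of g"
    unfolding coloring_of_def by (rule color_classes_cong) (rule swap)
  then have "labels G 3 (kempe_swap c i j C) (coloring_of g)" by (simp add: labels_def swap)
  moreover have "labels G 3 c (coloring_of f)" unfolding c_def by (rule labels_coloring_of)
  moreover have "i < 3" "j < 3" "i \<noteq> j"
    using e0G nz by (auto simp: i_def j_def value_color_eq_iff)
  ultimately show ?thesis unfolding kempe_change_def by blast
qed

text \<open>A Kempe change brings its own labelling \<open>c\<close>, whose colors may be a
  permutation of those of \<open>f\<close>. The walk first leads from \<open>f\<close> to
  \<open>flow_of c\<close>, which has the same coloring; the swap is then a single step of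
  flows.\<close>

lemma kempe_change_lift:
  assumes PQ: "(P, Q) \<in> parcs (kempe_graph G 3)"
    and f: "nowhere_zero_flow G f" and fP: "coloring_of f = P"
  obtains g where "nowhere_zero_flow G g" "coloring_of g = Q" "(f, g) \<in> flow_adj\<^sup>*"
proof -
  have P: "unlabelled_coloring G 3 P" and Q: "unlabelled_coloring G 3 Q"
    using PQ by (auto simp: kempe_graph_arcs_iff)
  obtain c i j C where c: "labels G 3 c P" "i < 3" "j < 3" "i \<noteq> j" "kempe_chain G c i j C"
    "labels G 3 (kempe_swap c i j C) Q"
    using PQ unfolding kempe_graph_arcs_iff kempe_change_def by blast
  let ?f = "flow_of c" and ?g = "flow_of (kempe_swap c i j C)"
  note fl = flow_of_coloring[OF c(1) P] and gl = flow_of_coloring[OF c(6) Q]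
  \<comment> \<open>The value of the color other than \<open>i\<close> and \<open>j\<close>: the
    edges of these two colors are those avoiding it.\<close>
  define a where "a = color_value i + color_value j"
  have a0: "a \<noteq> 0" using c(2-4) by (simp add: a_def bit_pair_add_eq_0_iff color_value_eq_iff)
  have less: "c e < 3" if "e \<in> arcs G" for e using c(1) that by (simp add: labels_def)
  have "(c e = i \<or> c e = j) \<longleftrightarrow> ?f e \<noteq> a" if "e \<in> arcs G" for e
    using bit_pair_ne_add_iff[of "color_value i" "color_value j" "color_value (c e)"] c(2-4) less[OF that] that
    by (simp add: a_def flow_of_def color_value_eq_iff)
  then have F: "{e \<in> arcs G. c e = i \<or> c e = j} = {e \<in> arcs G. ?f e \<noteq> a}" by blast
  have C: "cycle_subgraph C G" "arcs C \<subseteq> {e \<in> arcs G. c e = i \<or> c e = j}"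
    using c(5) max_connected_subgraph_iff_cycle[OF fl(1) a0]
    unfolding kempe_chain_def F by blast+
  have "?f e \<noteq> ?g e \<longleftrightarrow> e \<in> arcs C" if e: "e \<in> arcs G" for e
    using C(2) c(2-4) e by (auto simp: flow_of_def kempe_swap_def color_value_eq_iff)
  then have "arcs C = {e \<in> arcs G. ?f e \<noteq> ?g e}" using C(2) by blast
  then have "(?f, ?g) \<in> flow_adj" using C(1) fl(1) gl(1) flow_adj_iff by blast
  moreover have "(f, ?f) \<in> flow_adj\<^sup>*"
    using flow_adj_rtrancl_if_same_coloring[OF f fl(1)] fP fl(2) by simp
  ultimately have "(f, ?g) \<in> flow_adj\<^sup>*" by (rule rtrancl_into_rtrancl[rotated])
  with that gl show ?thesis by blast
qed

text \<open>\<open>coloring_of\<close> maps flows onto colorings and walks to walks, walks of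
  colorings lift, and each fibre is joined by walks; so connectedness passes both ways.\<close>

lemma connected_flow_graph_iff_connected_kempe_graph:
  "connected_or_empty (with_proj (flow_graph G :: ('e \<Rightarrow> bit \<times> bit) pair_pre_digraph))
    \<longleftrightarrow> connected_or_empty (with_proj (kempe_graph G 3))"
proof -
  let ?K = "parcs (kempe_graph G 3)"
  have "sym ?K" by (auto simp: sym_def kempe_graph_arcs_iff dest: kempe_change_sym)
  then have K: "connected_or_empty (with_proj (kempe_graph G 3)) \<longleftrightarrow>
      (\<forall>P Q. unlabelled_coloring G 3 P \<longrightarrow> unlabelled_coloring G 3 Q \<longrightarrow> (P, Q) \<in> ?K\<^sup>*)"
    by (subst connected_or_empty_with_proj_iff) (auto simp: kempe_graph_def)
  have F: "connected_or_empty (with_proj (flow_graph G :: ('e \<Rightarrow> bit \<times> bit) pair_pre_digraph)) \<longleftrightarrow>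
      (\<forall>f g. nowhere_zero_flow G f \<longrightarrow> nowhere_zero_flow G g \<longrightarrow> (f, g) \<in> flow_adj\<^sup>*)"
    using sym_flow_adj by (subst connected_or_empty_with_proj_iff) (auto simp: flow_graph_def)
  have surj: "\<exists>f. nowhere_zero_flow G f \<and> coloring_of f = P" if P: "unlabelled_coloring G 3 P" for P
    using unlabelled_coloring_obtain_labels[OF P] flow_of_coloring[OF _ P] by metis
  have project: "(coloring_of f, coloring_of g) \<in> ?K\<^sup>*" if "(f, g) \<in> flow_adj\<^sup>*" for f g
    using that
  proof induction
    case (step g h)
    have "(coloring_of g, coloring_of h) \<in> ?K\<^sup>*"
    \<comment> \<open>A step may swap two colors on their only chain; the coloring then stays the
      same, and the projected walk pauses because \<open>kempe_graph\<close> has no loops.\<close>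
    proof (cases "coloring_of g = coloring_of h")
      case False
      then have "(coloring_of g, coloring_of h) \<in> ?K"
        using kempe_change_if_flow_adj[OF step.hyps(2)] step.hyps(2) unlabelled_coloring_coloring_of
        by (simp add: kempe_graph_arcs_iff flow_adj_iff)
      then show ?thesis by simp
    qed simp
    with step.IH show ?case by (rule rtrancl_trans)
  qed simp
  have lift: "\<exists>g. nowhere_zero_flow G g \<and> coloring_of g = Q \<and> (f, g) \<in> flow_adj\<^sup>*"
    if "(coloring_of f, Q) \<in> ?K\<^sup>*" "nowhere_zero_flow G f" for f Q
    using that(1)
  proof induction
    case base
    then show ?case using that(2) by blast
  next
    case (step Q R)
    then show ?case by (metis kempe_change_lift rtrancl_trans)
  qed
  show ?thesis unfolding K F
  proof (intro iffI allI impI)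
    fix P Q assume "\<forall>f g. nowhere_zero_flow G f \<longrightarrow> nowhere_zero_flow G g \<longrightarrow> (f, g) \<in> flow_adj\<^sup>*"
      and "unlabelled_coloring G 3 P" "unlabelled_coloring G 3 Q"
    then show "(P, Q) \<in> ?K\<^sup>*" using surj project by metis
  next
    fix f g :: "'e \<Rightarrow> bit \<times> bit"
    assume conn: "\<forall>P Q. unlabelled_coloring G 3 P \<longrightarrow> unlabelled_coloring G 3 Q \<longrightarrow> (P, Q) \<in> ?K\<^sup>*"
      and fg: "nowhere_zero_flow G f" "nowhere_zero_flow G g"
    \<comment> \<open>The lifted walk ends in a flow with the coloring of \<open>g\<close>, possibly
      with permuted values; a walk realising the permutation completes it.\<close>
    then obtain h where "nowhere_zero_flow G h" "coloring_of h = coloring_of g" "(f, h) \<in> flow_adj\<^sup>*"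
      using lift unlabelled_coloring_coloring_of by metis
    then show "(f, g) \<in> flow_adj\<^sup>*"
      using flow_adj_rtrancl_if_same_coloring fg by (meson rtrancl_trans)
  qed
qed

end

theorem theorem4p1:
  fixes G :: "('v, 'e) pre_digraph"
  assumes "fin_digraph G" and "loopfree_digraph G" and "regular_graph 3 G"
  shows "connected_or_empty (with_proj (flow_graph G :: ('e \<Rightarrow> bit \<times> bit) pair_pre_digraph))
    \<longleftrightarrow> connected_or_empty (with_proj (kempe_graph G 3))"
proof -
  interpret cubic_graph G
    using assms by (simp add: cubic_graph_def cubic_graph_axioms_def)
  show ?thesis by (rule connected_flow_graph_iff_connected_kempe_graph)
qed

end
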